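(* Fix integers $b\geq 2$ and $N\geq 1$, and let $(U_n)_{n\geq 0}$ be the Lucas sequence of the first kind with integer parameters $(P,Q)$ satisfying: $|Q|=1$; $P^2-4Q>0$; and $U_n>0$ for all sufficiently large $n$. Let $\rho$ be the larger root of $x^2-Px+Q=0$. Then every at-most-$N$-digit-appending walk on $(U_n)$ in base $b$ terminates after at most $L$ steps, where \[ L \leq C_1\, N \log_\rho b + C_2 \] for constants $C_1,C_2>0$ depending only on $(P,Q)$.
   Context: For integers $P,Q$, the Lucas sequence of the first kind $U_n=U_n(P,Q)$ is defined by $U_0=0$, $U_1=1$, $U_{n+1}=PU_n-QU_{n-1}$. An at-most-$N$-digit-appending walk on $(U_n)$ in base $b$ is a finite or infinite sequence $M_0,M_1,M_2,\dots$ of terms of the sequence $(U_n)$ such that for each step $M_{j+1}=b^tM_j+r$ for some integers $1\leq t\leq N$ and $0\leq r<b^t$ (i.e. between $1$ and $N$ base-$b$ digits, leading zeros allowed, are appended on the right). The number of steps is the number of such transitions.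
   Formalization: Walks containing a step from 0 to 0 are excluded: since U_0 = 0 and 0 = b^t·0 + 0, the constant walk 0, 0, 0, … never terminates, so the claim is false as literally stated. *)

theory Defs
  imports Complex_Main "HOL-Library.Extended_Nat"
begin

fun lucasU :: "int \<Rightarrow> int \<Rightarrow> nat \<Rightarrow> int" where
  "lucasU P Q 0 = 0"
| "lucasU P Q (Suc 0) = 1"
| "lucasU P Q (Suc (Suc n)) = P * lucasU P Q (Suc n) - Q * lucasU P Q n"

definition append_step :: "int \<Rightarrow> nat \<Rightarrow> int \<Rightarrow> int \<Rightarrow> bool" where
  "append_step b N x y \<longleftrightarrow>
     (\<exists>(t::nat) (r::int). 1 \<le> t \<and> t \<le> N \<and> 0 \<le> r \<and> r < b ^ t \<and> y = b ^ t * x + r)"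

text \<open>Here \<open>s\<close> is the number of steps, so the walk is \<open>M 0, \<dots>, M s\<close> if \<open>s\<close> is finite and
  \<open>M 0, M 1, \<dots>\<close> if \<open>s = \<infinity>\<close>. Values of \<open>M\<close> beyond index \<open>s\<close> are irrelevant.
  As leading zeros may be appended, \<open>append_step b N 0 0\<close> holds for \<open>N \<ge> 1\<close> and
  \<open>b \<ge> 1\<close>, so on a sequence containing 0 the constant walk \<open>0, 0, \<dots>\<close> is allowed here.\<close>

definition appending_walk ::
  "(nat \<Rightarrow> int) \<Rightarrow> int \<Rightarrow> nat \<Rightarrow> (nat \<Rightarrow> int) \<Rightarrow> enat \<Rightarrow> bool" where
  "appending_walk U b N M s \<longleftrightarrow>
     (\<forall>j. enat j \<le> s \<longrightarrow> M j \<in> range U) \<and>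
     (\<forall>j. enat j < s \<longrightarrow> append_step b N (M j) (M (Suc j)))"

end

theory Submission
  imports Defs
begin

text \<open>Let \<open>U\<^sub>m = b\<^sup>t U\<^sub>n + r\<close> be a step, \<open>B = b\<^sup>t\<close> and \<open>m = n + k\<close>. The growth of \<open>U\<close> forces
  \<open>U\<^sub>k < 2 B\<close>, so \<open>k\<close> is at most \<open>log\<^sub>\<rho> B\<close> up to a constant. If \<open>n > k\<close>, the identity
  \<open>U\<^sub>n\<^sub>+\<^sub>k = V\<^sub>k U\<^sub>n - Q\<^sup>k U\<^sub>n\<^sub>-\<^sub>k\<close>, with \<open>V\<close> the companion sequence, gives
  \<open>r = (V\<^sub>k - B) U\<^sub>n - Q\<^sup>k U\<^sub>n\<^sub>-\<^sub>k\<close>. As \<open>|Q| = 1\<close>, here \<open>V\<^sub>k < B\<close> contradicts \<open>r \<ge> 0\<close>, while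
  \<open>V\<^sub>k = B\<close> and \<open>V\<^sub>k > B\<close> make \<open>r\<close> at least \<open>U\<^sub>n\<^sub>-\<^sub>k\<close> and \<open>U\<^sub>n\<^sub>-\<^sub>2\<close> respectively; since \<open>r < B\<close>,
  always \<open>n \<le> 2 log\<^sub>\<rho> B + O(1)\<close>. The terms of a walk increase, so there are at most that many
  steps.\<close>

section \<open>Identities for Lucas sequences\<close>

lemma lucasU_uminus: "lucasU (- P) Q n = (- 1) ^ Suc n * lucasU P Q n"
  by (induction P Q n rule: lucasU.induct) (simp_all add: algebra_simps)

lemma lucasU_add:
  "lucasU P Q (Suc n + k) = lucasU P Q (Suc k) * lucasU P Q (Suc n) - Q * lucasU P Q k * lucasU P Q n"
proof (induction k rule: induct_nat_012)
  case (ge2 k)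
  have "lucasU P Q (Suc n + Suc (Suc k)) = P * lucasU P Q (Suc n + Suc k) - Q * lucasU P Q (Suc n + k)"
    by simp
  then show ?case
    unfolding ge2.IH by (simp add: algebra_simps)
qed simp_all

text \<open>The witness is the companion sequence \<open>V\<^sub>0 = 2\<close>, \<open>V\<^sub>1 = P\<close>, \<open>V\<^sub>k\<^sub>+\<^sub>2 = P V\<^sub>k\<^sub>+\<^sub>1 - Q V\<^sub>k\<close>.\<close>

lemma lucasU_companion:
  "\<exists>V. \<forall>i. lucasU P Q (i + 2 * k) = V * lucasU P Q (i + k) - Q ^ k * lucasU P Q i"
proof (induction k rule: induct_nat_012)
  case 0
  show ?case by (intro exI[of _ 2]) simp
next
  case 1
  show ?case by (intro exI[of _ P]) simp
next
  case (ge2 k)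
  obtain V W where
    V: "\<And>i. lucasU P Q (i + 2 * k) = V * lucasU P Q (i + k) - Q ^ k * lucasU P Q i" and
    W: "\<And>i. lucasU P Q (i + 2 * Suc k) = W * lucasU P Q (i + Suc k) - Q ^ Suc k * lucasU P Q i"
    using ge2.IH by blast
  have "lucasU P Q (i + 2 * Suc (Suc k)) =
      (P * W - Q * V) * lucasU P Q (i + Suc (Suc k)) - Q ^ Suc (Suc k) * lucasU P Q i" for i
  proof -
    \<comment> \<open>The recurrence at the top index is split so that both induction hypotheses
      share the middle index \<open>i + k + 2\<close>; the remaining terms combine by the recurrence
      for \<open>U (i + 2)\<close>.\<close>
    have "lucasU P Q (i + 2 * Suc (Suc k)) =
        P * lucasU P Q (Suc i + 2 * Suc k) - Q * lucasU P Q (Suc (Suc i) + 2 * k)"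
      by simp
    also have "\<dots> = P * (W * lucasU P Q (Suc i + Suc k) - Q ^ Suc k * lucasU P Q (Suc i)) -
        Q * (V * lucasU P Q (Suc (Suc i) + k) - Q ^ k * lucasU P Q (Suc (Suc i)))"
      by (simp only: V W)
    finally show ?thesis by (simp add: algebra_simps)
  qed
  then show ?case by blast
qed

text \<open>Appending at least one digit at least doubles a nonnegative number, so only the step
  from 0 to 0 fails to increase.\<close>

lemma append_step_less:
  assumes "append_step b N x y" and "0 \<le> x" and "\<not> (x = 0 \<and> y = 0)" and "2 \<le> b"
  shows "x < y"
proof -
  obtain t r where t: "1 \<le> t" and r: "0 \<le> r" and y: "y = b ^ t * x + r"
    using assms(1) unfolding append_step_def by blast
  have "2 \<le> b ^ t"
    using \<open>2 \<le> b\<close> self_le_power[of b t] t by linarith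
  then have "2 * x \<le> b ^ t * x"
    using \<open>0 \<le> x\<close> by (rule mult_right_mono)
  then have "2 * x \<le> y" and "x = 0 \<Longrightarrow> 0 < y"
    using y r assms(3) by auto
  then show ?thesis using \<open>0 \<le> x\<close> by linarith
qed

section \<open>Monotonicity and growth for admissible parameters\<close>

text \<open>These are exactly the pairs that unit \<open>Q\<close>, positive discriminant and
  eventual positivity leave; for \<open>Q = 1\<close> the discriminant excludes
  \<open>P = 2\<close>, where \<open>U n = n\<close> grows only linearly.\<close>

locale unit_lucas =
  fixes P Q :: int
  assumes PQ: "Q = - 1 \<and> 1 \<le> P \<or> Q = 1 \<and> 3 \<le> P"
begin

abbreviation U :: "nat \<Rightarrow> int" where
  "U \<equiv> lucasU P Q"

lemma lucasU_nonneg_le_Suc: "0 \<le> U n \<and> U n \<le> U (Suc n)"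
proof (induction n)
  case (Suc n)
  have "1 * U (Suc n) \<le> P * U (Suc n)" if "1 \<le> P"
    using that Suc by (intro mult_right_mono) auto
  moreover have "3 * U (Suc n) \<le> P * U (Suc n)" if "3 \<le> P"
    using that Suc by (intro mult_right_mono) auto
  ultimately show ?case using PQ Suc by auto
qed simp

lemma lucasU_nonneg: "0 \<le> U n"
  using lucasU_nonneg_le_Suc by blast

lemma lucasU_mono: "m \<le> n \<Longrightarrow> U m \<le> U n"
  by (rule lift_Suc_mono_le[of U]) (simp_all only: lucasU_nonneg_le_Suc)

lemma lucasU_pos: "0 < n \<Longrightarrow> 0 < U n"
  using lucasU_mono[of 1 n] by simp

lemma lucasU_Suc_Suc_ge: "U n + U (Suc n) \<le> U (Suc (Suc n))"
proof -
  have "1 * U (Suc n) \<le> P * U (Suc n)" if "1 \<le> P"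
    using that lucasU_nonneg by (intro mult_right_mono) auto
  moreover have "3 * U (Suc n) \<le> P * U (Suc n)" if "3 \<le> P"
    using that lucasU_nonneg by (intro mult_right_mono) auto
  ultimately show ?thesis using PQ lucasU_nonneg_le_Suc[of n] by auto
qed

text \<open>By the addition formula, \<open>U (n + k)\<close> is \<open>U (k + 1) * U n\<close>
  minus \<open>Q * U k * U (n - 1)\<close>. For \<open>Q = - 1\<close> the second term only helps;
  for \<open>Q = 1\<close> it costs at most \<open>U k * U n\<close>, which
  \<open>U (k + 1) \<ge> 2 * U k\<close> pays for.\<close>

lemma lucasU_mult_le:
  assumes "0 < n"
  shows "U k * U n \<le> U (n + k)"
proof -
  obtain m where n: "n = Suc m"
    using assms by (cases n) auto
  note add = lucasU_add[of P Q m k]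
  have "U k * U n \<le> U (Suc k) * U n"
    using lucasU_nonneg_le_Suc lucasU_nonneg by (intro mult_right_mono) auto
  moreover have "0 \<le> U k * U m"
    using lucasU_nonneg by simp
  moreover have "(U k + U k) * U n \<le> U (Suc k) * U n" if "Q = 1"
  proof (intro mult_right_mono lucasU_nonneg)
    show "U k + U k \<le> U (Suc k)"
    proof (cases k)
      case (Suc l)
      have "3 * U k \<le> P * U k"
        using that PQ lucasU_nonneg by (intro mult_right_mono) auto
      then show ?thesis
        using Suc that lucasU_nonneg_le_Suc[of l] by simp
    qed simp
  qed
  moreover have "U k * U m \<le> U k * U n"
    using n lucasU_nonneg_le_Suc lucasU_nonneg by (intro mult_left_mono) auto
  ultimately show ?thesis
    using PQ add n by (auto simp: algebra_simps)
qed

section \<open>Comparison with powers of the larger root\<close>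

text \<open>The other root is \<open>P - \<rho>\<close>, so \<open>\<rho> \<ge> P / 2\<close>, which
  suffices for \<open>Q = 1\<close>. For \<open>Q = - 1\<close> the roots have opposite signs,
  whence \<open>\<rho> > P \<ge> 1\<close>.\<close>

lemma root_gt_1:
  fixes \<rho> :: real
  assumes root: "\<rho>\<^sup>2 - of_int P * \<rho> + of_int Q = 0"
    and max: "\<And>x::real. x\<^sup>2 - of_int P * x + of_int Q = 0 \<Longrightarrow> x \<le> \<rho>"
  shows "1 < \<rho>"
proof -
  have conj: "of_int P - \<rho> \<le> \<rho>"
    by (rule max) (use root in \<open>simp add: power2_eq_square algebra_simps\<close>)
  have prod: "\<rho> * (of_int P - \<rho>) = of_int Q"
    using root by (simp add: power2_eq_square algebra_simps)
  show ?thesis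
  proof (cases "Q = 1")
    case True
    then have "3 \<le> real_of_int P" using PQ by linarith
    with conj show ?thesis by linarith
  next
    case False
    then have Q: "Q = - 1" and P: "1 \<le> real_of_int P" using PQ by auto
    have "0 < \<rho>" using conj P by linarith
    moreover have "\<rho> * (of_int P - \<rho>) < 0" using prod Q by simp
    ultimately have "of_int P - \<rho> < 0" by (simp add: mult_less_0_iff)
    with P show ?thesis by linarith
  qed
qed

text \<open>The index shift is 2 because a shift of 1 fails for Fibonacci numbers:
  \<open>\<rho> > 1 = U 2\<close>. Two consecutive bounds are stated together to feed the
  second-order recurrence when \<open>Q = - 1\<close>.\<close>

lemma root_power_le_lucasU:
  fixes \<rho> :: real
  assumes root: "\<rho>\<^sup>2 - of_int P * \<rho> + of_int Q = 0" and "1 < \<rho>"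
  shows "\<rho> ^ n \<le> of_int (U (Suc (Suc n))) \<and> \<rho> ^ Suc n \<le> of_int (U (Suc (Suc (Suc n))))"
proof (cases "Q = 1")
  case True
  have inv: "of_int P = \<rho> + 1 / \<rho>"
    using root True \<open>1 < \<rho>\<close> by (simp add: field_simps power2_eq_square)
  \<comment> \<open>With \<open>P = \<rho> + 1 / \<rho>\<close>, the recurrence yields
    \<open>\<rho> * U (n + 1)\<close> plus the term \<open>U (n + 1) / \<rho> - U n\<close>,
    nonnegative by induction.\<close>
  have step: "\<rho> * of_int (U n) \<le> of_int (U (Suc n))" for n
  proof (induction n)
    case (Suc n)
    have "of_int (U n) \<le> of_int (U (Suc n)) / \<rho>"
      using Suc \<open>1 < \<rho>\<close> by (simp add: field_simps)
    then show ?case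
      using True by (simp add: inv algebra_simps)
  qed simp
  have "\<rho> ^ n \<le> of_int (U (Suc n))" for n
  proof (induction n)
    case (Suc n)
    have "\<rho> * \<rho> ^ n \<le> \<rho> * of_int (U (Suc n))"
      using Suc \<open>1 < \<rho>\<close> by simp
    then show ?case using step[of "Suc n"] by (simp del: lucasU.simps)
  qed simp
  moreover have "real_of_int (U (Suc n)) \<le> of_int (U (Suc (Suc n)))" for n
    using lucasU_nonneg_le_Suc by (simp del: lucasU.simps)
  ultimately have "\<rho> ^ n \<le> of_int (U (Suc (Suc n)))" for n
    by (rule order_trans)
  then show ?thesis by blast
next
  case False
  then have Q: "Q = - 1" and P: "1 \<le> P" using PQ by auto
  have sq: "\<rho> * \<rho> = of_int P * \<rho> + 1"
    using root Q by (simp add: power2_eq_square)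
  have P': "1 \<le> real_of_int P" using P by linarith
  show ?thesis
  proof (induction n)
    case 0
    \<comment> \<open>The second base inequality is \<open>\<rho> \<le> U 3 = P * P + 1\<close>; it
      follows from \<open>\<rho> = P + 1 / \<rho> < P + 1\<close>.\<close>
    have "\<rho> * \<rho> \<le> \<rho> * (of_int P + 1)"
      using sq \<open>1 < \<rho>\<close> by (simp add: algebra_simps)
    then have "\<rho> \<le> of_int P + 1" using \<open>1 < \<rho>\<close> by simp
    moreover have "1 * real_of_int P \<le> of_int P * of_int P"
      using P' by (intro mult_right_mono) auto
    ultimately have "\<rho> \<le> of_int P * of_int P + 1" by linarith
    then show ?case using P Q by simp
  next
    case (Suc n)
    have "\<rho> ^ Suc (Suc n) = of_int P * \<rho> ^ Suc n + \<rho> ^ n"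
      using arg_cong[OF sq, of "\<lambda>x. x * \<rho> ^ n"] by (simp add: algebra_simps)
    also have "\<dots> \<le> of_int P * of_int (U (Suc (Suc (Suc n)))) + of_int (U (Suc (Suc n)))"
      using Suc P' by (intro add_mono mult_left_mono) (auto simp del: lucasU.simps)
    also have "\<dots> = of_int (U (Suc (Suc (Suc (Suc n)))))"
      by (subst (3) lucasU.simps) (simp del: lucasU.simps add: Q)
    finally show ?case using Suc by blast
  qed
qed

lemma index_le_log:
  fixes \<rho> :: real
  assumes root: "\<rho>\<^sup>2 - of_int P * \<rho> + of_int Q = 0" and "1 < \<rho>"
    and "U n \<le> B" and "1 \<le> B"
  shows "real n \<le> log \<rho> (of_int B) + 2"
proof (cases "n < 2")
  case True
  have "0 \<le> log \<rho> (of_int B)"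
    using assms by simp
  then show ?thesis using True by linarith
next
  case False
  then obtain m where n: "n = Suc (Suc m)"
    by (metis add_2_eq_Suc le_Suc_ex not_less)
  have "\<rho> ^ m \<le> of_int (U n)"
    using root_power_le_lucasU[OF root \<open>1 < \<rho>\<close>] n by blast
  also have "\<dots> \<le> of_int B"
    using \<open>U n \<le> B\<close> by simp
  finally have "real m \<le> log \<rho> (of_int B)"
    using \<open>1 < \<rho>\<close> le_log_of_power by blast
  then show ?thesis using n by simp
qed

section \<open>Bounding the index at which a step can start\<close>

lemma append_index_gap:
  assumes "0 < n" and eq: "U (n + k) = B * U n + r" and "r < B" and "2 \<le> B"
  shows "U k \<le> 2 * B"
proof -
  have pos: "1 \<le> U n" using lucasU_pos[OF \<open>0 < n\<close>] by simp
  have "U k * U n \<le> B * U n + r"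
    using lucasU_mult_le[OF \<open>0 < n\<close>, of k] eq by simp
  also have "\<dots> \<le> B * U n + B * U n"
    using pos assms mult_left_mono[of 1 "U n" B] by linarith
  finally have "U k * U n \<le> (2 * B) * U n" by (simp add: algebra_simps)
  then show ?thesis using pos by simp
qed

text \<open>Each alternative bounds \<open>n\<close> logarithmically: the first two with the help of
  the bound on \<open>k\<close> from \<open>append_index_gap\<close>, the third directly.\<close>

lemma append_index_cases:
  assumes "0 < k" and "3 \<le> n" and eq: "U (n + k) = B * U n + r"
    and "0 \<le> r" and "r < B"
  shows "n \<le> k \<or> U (n - k) \<le> B \<or> U (n - 2) \<le> B"
proof (rule disjCI)
  assume *: "\<not> (U (n - k) \<le> B \<or> U (n - 2) \<le> B)"
  show "n \<le> k"
  proof (rule ccontr)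
    assume "\<not> n \<le> k"
    then obtain i where i: "n = i + k" "0 < i"
      by (metis add.commute less_imp_add_positive not_le)
    obtain V where V: "\<And>j. U (j + 2 * k) = V * U (j + k) - Q ^ k * U j"
      using lucasU_companion[of P Q k] by blast
    have r: "r = (V - B) * U n - Q ^ k * U i"
    proof -
      have "n + k = i + 2 * k" using i by simp
      then have "B * U n + r = V * U n - Q ^ k * U i"
        using V[of i] eq i by metis
      then show ?thesis by (simp add: algebra_simps)
    qed
    \<comment> \<open>\<open>n \<ge> 3\<close> makes \<open>U (n - 2)\<close> positive, so that
      \<open>V < B\<close> gives \<open>r \<le> - U (n - 2) < 0\<close>.\<close>
    obtain l where l: "n = Suc (Suc (Suc l))"
      using \<open>3 \<le> n\<close> by (metis add_Suc add_0 le_Suc_ex numeral_3_eq_3)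
    have Qk: "Q ^ k = 1 \<or> Q ^ k = - 1"
      using PQ by (cases "even k") auto
    \<comment> \<open>Since \<open>i = n - k \<le> n - 1\<close>, the term
      \<open>Q ^ k * U i\<close> cannot outweigh one copy of \<open>U n\<close>, and
      \<open>U (n - 2)\<close> is left over. This settles both \<open>V < B\<close> and
      \<open>V > B\<close>.\<close>
    have gap: "U (n - 2) + U i \<le> U n"
    proof -
      have "i \<le> Suc (Suc l)" using i \<open>0 < k\<close> l by linarith
      then have "U i \<le> U (Suc (Suc l))" by (rule lucasU_mono)
      then show ?thesis
        using lucasU_Suc_Suc_ge[of "Suc l"] l by (simp del: lucasU.simps)
    qed
    have pos: "0 < U (n - 2)" "0 < U i"
      using lucasU_pos i l by simp_all
    consider "V - B \<le> - 1" | "V = B" | "1 \<le> V - B" by linarith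
    then show False
    proof cases
      case 1
      then have "(V - B) * U n \<le> - 1 * U n"
        using lucasU_nonneg by (intro mult_right_mono)
      then show False using r Qk gap pos \<open>0 \<le> r\<close> by auto
    next
      case 2
      then show False using r Qk pos \<open>0 \<le> r\<close> \<open>r < B\<close> * i by auto
    next
      case 3
      then have "1 * U n \<le> (V - B) * U n"
        using lucasU_nonneg by (intro mult_right_mono)
      moreover have "Q ^ k * U i \<le> U i" using Qk pos by auto
      ultimately show False using r gap \<open>r < B\<close> * by linarith
    qed
  qed
qed

lemma append_step_index_le:
  fixes \<rho> :: real
  assumes root: "\<rho>\<^sup>2 - of_int P * \<rho> + of_int Q = 0" and "1 < \<rho>"
    and step: "append_step b N (U n) (U m)" and "0 < U n" and "2 \<le> b"
  shows "real n \<le> 2 * real N * log \<rho> (of_int b) + log \<rho> 2 + 4"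
proof -
  obtain t r where t: "1 \<le> t" "t \<le> N" and r: "0 \<le> r" "r < b ^ t"
    and eq: "U m = b ^ t * U n + r"
    using step unfolding append_step_def by blast
  define B where "B = b ^ t"
  have B: "2 \<le> B"
    using \<open>2 \<le> b\<close> self_le_power[of b t] t unfolding B_def by linarith
  have n: "0 < n" using \<open>0 < U n\<close> by (cases n) auto
  have "2 * U n \<le> B * U n"
    using B \<open>0 < U n\<close> by (intro mult_right_mono) auto
  then have "U n < U m" using eq r \<open>0 < U n\<close> unfolding B_def by linarith
  then have "n < m" using lucasU_mono by (meson not_less)
  then obtain k where k: "m = n + k" "0 < k"
    using less_imp_add_positive by blast
  have "U k \<le> 2 * B"
    using append_index_gap[OF n] eq r B k unfolding B_def by blast
  then have "real k \<le> log \<rho> (of_int (2 * B)) + 2"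
    using index_le_log[OF root \<open>1 < \<rho>\<close>, of k "2 * B"] B by linarith
  also have "log \<rho> (of_int (2 * B)) = log \<rho> 2 + log \<rho> (of_int B)"
    using B \<open>1 < \<rho>\<close> by (simp add: log_mult)
  finally have k_le: "real k \<le> log \<rho> 2 + log \<rho> (of_int B) + 2" .
  have log_nonneg: "0 \<le> log \<rho> 2" "0 \<le> log \<rho> (of_int B)" "0 \<le> log \<rho> (of_int b)"
    using B \<open>1 < \<rho>\<close> \<open>2 \<le> b\<close> by simp_all
  \<comment> \<open>The worst case is \<open>U (n - k) \<le> B\<close>: the bounds for
    \<open>n - k\<close> and for \<open>k\<close> add up, each contributing one logarithm of
    \<open>B\<close> and the shift 2.\<close>
  have "real n \<le> 2 * log \<rho> (of_int B) + log \<rho> 2 + 4"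
  proof (cases "3 \<le> n")
    case True
    consider "n \<le> k" | "U (n - k) \<le> B" | "U (n - 2) \<le> B"
      using append_index_cases[OF \<open>0 < k\<close> True] eq r k unfolding B_def by blast
    then show ?thesis
    proof cases
      case 1
      then show ?thesis using k_le log_nonneg by linarith
    next
      case 2
      then have "real (n - k) \<le> log \<rho> (of_int B) + 2"
        using index_le_log[OF root \<open>1 < \<rho>\<close>] B by simp
      then show ?thesis using k_le by linarith
    next
      case 3
      then have "real (n - 2) \<le> log \<rho> (of_int B) + 2"
        using index_le_log[OF root \<open>1 < \<rho>\<close>] B by simp
      then show ?thesis using log_nonneg by linarith
    qed
  qed (use log_nonneg in linarith)
  moreover have "log \<rho> (of_int B) = real t * log \<rho> (of_int b)"
    using \<open>2 \<le> b\<close> unfolding B_def by (simp add: log_nat_power)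
  moreover have "real t * log \<rho> (of_int b) \<le> real N * log \<rho> (of_int b)"
    using t log_nonneg by (intro mult_right_mono) auto
  ultimately show ?thesis by linarith
qed

section \<open>Length of a walk\<close>

text \<open>Pigeonhole: a longer walk would have \<open>L + 2\<close> distinct terms, each the start
  of a step and hence among the \<open>L + 1\<close> values \<open>U 0\<close>, ...,
  \<open>U L\<close>. The argument covers infinite walks as well.\<close>

lemma appending_walk_length:
  fixes \<rho> :: real
  assumes root: "\<rho>\<^sup>2 - of_int P * \<rho> + of_int Q = 0" and "1 < \<rho>" and "2 \<le> b"
    and walk: "appending_walk U b N M s"
    and nonzero: "\<And>j. enat j < s \<Longrightarrow> \<not> (M j = 0 \<and> M (Suc j) = 0)"
  shows "s \<le> enat (nat \<lfloor>2 * real N * log \<rho> (of_int b) + log \<rho> 2 + 4\<rfloor> + 1)"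
    (is "s \<le> enat (nat \<lfloor>?K\<rfloor> + 1)")
proof (rule ccontr)
  define L where "L = nat \<lfloor>?K\<rfloor>"
  assume "\<not> ?thesis"
  \<comment> \<open>Strictness matters: even the term \<open>M (L + 1)\<close> has a successor, so
    the index bound applies to it.\<close>
  then have long: "enat (L + 1) < s" unfolding L_def by simp
  have lt: "enat j < s" if "j \<le> L + 1" for j
    using that long by (meson enat_ord_simps(1) order_le_less_trans)
  have rng: "M j \<in> range U" if "enat j \<le> s" for j
    using walk that unfolding appending_walk_def by blast
  have step: "append_step b N (M j) (M (Suc j))" if "enat j < s" for j
    using walk that unfolding appending_walk_def by blast
  have incr: "M j < M (Suc j)" if "enat j < s" for j
  proof -
    have "0 \<le> M j"
      using rng[OF less_imp_le[OF that]] lucasU_nonneg by auto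
    then show ?thesis
      by (rule append_step_less[OF step[OF that] _ nonzero[OF that] \<open>2 \<le> b\<close>])
  qed
  have less: "M i < M j" if "i < j" "j \<le> L + 1" for i j
    using that
  proof (induction j)
    case (Suc j)
    have "M j < M (Suc j)" using incr lt Suc.prems by simp
    then show ?case using Suc by (cases "i = j") auto
  qed simp
  then have "inj_on M {..L + 1}"
    by (intro strict_mono_on_imp_inj_on strict_mono_onI) auto
  moreover have "M ` {..L + 1} \<subseteq> U ` {..L}"
  proof
    fix x assume "x \<in> M ` {..L + 1}"
    then obtain j where j: "x = M j" "enat j < s"
      using lt by auto
    obtain n where n: "M j = U n" using rng[OF less_imp_le[OF j(2)]] by blast
    obtain m where m: "M (Suc j) = U m"
      using rng[of "Suc j"] j(2) by (auto simp: Suc_ile_eq)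
    show "x \<in> U ` {..L}"
    \<comment> \<open>The index bound for steps requires a positive start; a start of 0 is the value
      \<open>U 0\<close> anyway.\<close>
    proof (cases "U n = 0")
      case True
      then have "x = U 0" using j n by simp
      then show ?thesis by blast
    next
      case False
      then have "real n \<le> ?K"
        using append_step_index_le[OF root \<open>1 < \<rho>\<close> _ _ \<open>2 \<le> b\<close>] step[OF j(2)] n m lucasU_nonneg[of n]
        by simp
      then have "n \<le> L" unfolding L_def by (rule le_nat_floor)
      then show ?thesis using j n by blast
    qed
  qed
  ultimately have "card {..L + 1} \<le> card (U ` {..L})"
    by (intro card_inj_on_le) auto
  also have "\<dots> \<le> card {..L}" by (rule card_image_le) simp
  finally show False by simp
qed

end

section \<open>From the hypotheses to the final constants\<close>

text \<open>Even-indexed terms rule out \<open>P \<le> 0\<close>: they vanish for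
  \<open>P = 0\<close>, and for negative \<open>P\<close> they are the negatives of the nonnegative
  terms with parameter \<open>- P\<close>.\<close>

lemma unit_lucas_if_eventually_pos:
  assumes "\<bar>Q\<bar> = 1" and "P\<^sup>2 - 4 * Q > 0" and "\<forall>\<^sub>F n in sequentially. lucasU P Q n > 0"
  shows "unit_lucas P Q"
proof -
  obtain n0 where n0: "\<And>n. n0 \<le> n \<Longrightarrow> 0 < lucasU P Q n"
    using assms(3) unfolding eventually_sequentially by blast
  have large: "Q = 1 \<Longrightarrow> 2 < \<bar>P\<bar>"
    using assms(2) power2_le_iff_abs_le[of 2 P] by auto
  have "0 < P"
  proof (rule ccontr)
    assume "\<not> 0 < P"
    then consider "P = 0" "Q = - 1" | "unit_lucas (- P) Q"
      using large assms(1) unfolding unit_lucas_def by linarith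
    then show False
    proof cases
      case 1
      have "lucasU 0 (- 1) (2 * n) = 0" for n
        by (induction n) auto
      then show False using n0[of "2 * n0"] 1 by simp
    next
      case 2
      then have "0 \<le> lucasU (- P) Q (2 * n0)"
        by (rule unit_lucas.lucasU_nonneg)
      then show False using n0[of "2 * n0"] by (simp add: lucasU_uminus)
    qed
  qed
  then show ?thesis
    using large assms(1) unfolding unit_lucas_def by linarith
qed

text \<open>The condition on consecutive zeros excludes steps from 0 to 0; as
  \<open>U 0 = 0\<close>, these would permit the infinite constant walk 0, 0, ....\<close>

theorem theorem4p2:
  fixes P Q :: int and \<rho> :: real
  assumes "\<bar>Q\<bar> = 1"
    and "P\<^sup>2 - 4 * Q > 0"
    and "\<forall>\<^sub>F n in sequentially. lucasU P Q n > 0"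
    and "\<rho>\<^sup>2 - of_int P * \<rho> + of_int Q = 0"
    and "\<And>x::real. x\<^sup>2 - of_int P * x + of_int Q = 0 \<Longrightarrow> x \<le> \<rho>"
  shows "\<exists>C\<^sub>1>0. \<exists>C\<^sub>2>0. \<forall>(b::int) (N::nat). 2 \<le> b \<and> 1 \<le> N \<longrightarrow>
    (\<exists>L::nat. real L \<le> C\<^sub>1 * real N * log \<rho> (of_int b) + C\<^sub>2 \<and>
      (\<forall>M s. appending_walk (lucasU P Q) b N M s \<and>
             (\<forall>j. enat j < s \<longrightarrow> \<not> (M j = 0 \<and> M (Suc j) = 0))
        \<longrightarrow> s \<le> enat L))"
proof -
  interpret unit_lucas P Q
    using assms(1-3) by (rule unit_lucas_if_eventually_pos)
  have \<rho>: "1 < \<rho>" using assms(4,5) by (rule root_gt_1)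
  have logs: "0 \<le> log \<rho> 2" "\<And>b::int. 2 \<le> b \<Longrightarrow> 0 \<le> log \<rho> (of_int b)"
    using \<rho> by simp_all
  \<comment> \<open>The constants are \<open>C\<^sub>1 = 2\<close> and
    \<open>C\<^sub>2 = log \<rho> 2 + 5\<close>: 4 comes from the index bound and 1 from the
    pigeonhole count.\<close>
  have "\<exists>L::nat. real L \<le> 2 * real N * log \<rho> (of_int b) + (log \<rho> 2 + 5) \<and>
      (\<forall>M s. appending_walk U b N M s \<and> (\<forall>j. enat j < s \<longrightarrow> \<not> (M j = 0 \<and> M (Suc j) = 0))
        \<longrightarrow> s \<le> enat L)" if "2 \<le> b \<and> 1 \<le> N" for b N
  proof (intro exI conjI allI impI)
    let ?K = "2 * real N * log \<rho> (of_int b) + log \<rho> 2 + 4"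
    have "0 \<le> ?K" using logs that by simp
    then show "real (nat \<lfloor>?K\<rfloor> + 1) \<le> 2 * real N * log \<rho> (of_int b) + (log \<rho> 2 + 5)"
      by linarith
    fix M s
    assume "appending_walk U b N M s \<and> (\<forall>j. enat j < s \<longrightarrow> \<not> (M j = 0 \<and> M (Suc j) = 0))"
    then show "s \<le> enat (nat \<lfloor>?K\<rfloor> + 1)"
      using that by (intro appending_walk_length[OF assms(4) \<rho>, of b N M s]) simp_all
  qed
  moreover have "(0::real) < 2" "0 < log \<rho> 2 + 5"
    using logs by simp_all
  ultimately show ?thesis by blast
qed

end
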